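(* Let $\mathrm{QMP}1$ and $\mathrm{QMP}2$ be the spaces of all quantum matrix pairs of type I and type II respectively, with entries in an algebra $\mathcal A$ over a field $k$, and with a fixed parameter $q$ (where $q\in k$ is invertible, $q\neq 1$). Then the following definitions give rise to representations of $SL(2,\mathbf Z)$ on $\mathrm{QMP}1$ and $\mathrm{QMP}2$: $$\mathrm{QMP}1:\quad S(U_1,U_2)=(U_2,U_1^{-1}),\qquad T(U_1,U_2)=(q^{-1/2}U_1U_2,\,U_2),$$ $$\mathrm{QMP}2:\quad S(U_1,U_2)=(U_2,U_1^{-1}),\qquad T(U_1,U_2)=(U_1U_2,\,U_2).$$
   Context: The matrices are upper triangular, $U_i=\begin{pmatrix}\alpha_i&\beta_i\\0&\gamma_i\end{pmatrix}$, $i=1,2$, with entries in $\mathcal A$ and with $\alpha_i,\gamma_i$ invertible, so that $U_i$ is invertible. Consider the following relations, where those with index $i$ are required for $i=1,2$: (ID1) $\alpha_i\gamma_i=\gamma_i\alpha_i=1$. (ID2) $\alpha_i\gamma_i=\gamma_i\alpha_i$. (IND1) $\alpha_i\beta_i=\beta_i\gamma_i$. (MD1) $\alpha_1\alpha_2=q\alpha_2\alpha_1$. (MD2) $\alpha_1\alpha_2=q\alpha_2\alpha_1$, $\alpha_1\gamma_2=q^{-1}\gamma_2\alpha_1$, $\alpha_2\gamma_1=q\gamma_1\alpha_2$, $\gamma_1\gamma_2=q\gamma_2\gamma_1$. (MND) $\alpha_1\beta_2=q\beta_2\gamma_1$, $\beta_1\gamma_2=q\alpha_2\beta_1$. The pair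 $(U_1,U_2)$ is a quantum matrix pair of type I with parameter $q$ if (ID1), (IND1), (MD1), (MND) hold, and of type II with parameter $q$ if (ID2), (IND1), (MD2), (MND) hold. In both types $U_1U_2=qU_2U_1$. $SL(2,\mathbf Z)$ is the modular group, the group of $2\times2$ integer matrices of determinant $1$; the paper describes it as having a presentation in terms of two generators $S$ and $T$ with relations $S^4=(ST)^3=1$. A representation of $SL(2,\mathbf Z)$ on a space $X$ is an action of this group on $X$ by automorphisms, given here by the automorphisms $S$ and $T$ of $X$ representing the two generators. Products are compositions, $(ST)(U_1,U_2)=S(T(U_1,U_2))$.
   Formalization: On QMP2 only that S, T are bijections with S^4=(ST)^3=1 is proved: these relations do not present SL(2,Z), and no action of SL(2,Z) exists on a non-empty QMP2, since S^2T and TS^2 differ there by the factor q≠1. On QMP1 a genuine action of SL(2,Z) is proved. *)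

theory Defs
  imports "HOL-Analysis.Determinants" "HOL-Algebra.Group_Action"
begin

text \<open>Associative unital algebras over a field; not necessarily commutative, unlike the
  locale \<open>algebra\<close> of HOL-Algebra.\<close>

locale algebra_over_field = vector_space smul
  for smul :: "'k::field \<Rightarrow> 'a::ring_1 \<Rightarrow> 'a" +
  assumes smul_mult_left: "smul c x * y = smul c (x * y)"
    and smul_mult_right: "x * smul c y = smul c (x * y)"

section \<open>Quantum matrix pairs\<close>

abbreviation mat_alpha :: "'a^2^2 \<Rightarrow> 'a" where "mat_alpha U \<equiv> U $ 1 $ 1"
abbreviation mat_beta :: "'a^2^2 \<Rightarrow> 'a" where "mat_beta U \<equiv> U $ 1 $ 2"
abbreviation mat_gamma :: "'a^2^2 \<Rightarrow> 'a" where "mat_gamma U \<equiv> U $ 2 $ 2"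

definition invertible_elem :: "'a::monoid_mult \<Rightarrow> bool" where
  "invertible_elem a \<longleftrightarrow> (\<exists>b. a * b = 1 \<and> b * a = 1)"

definition inv_upper_triangular :: "'a::ring_1^2^2 \<Rightarrow> bool" where
  "inv_upper_triangular U \<longleftrightarrow>
     U $ 2 $ 1 = 0 \<and> invertible_elem (mat_alpha U) \<and> invertible_elem (mat_gamma U)"

definition ID1 :: "'a::ring_1^2^2 \<Rightarrow> bool" where
  "ID1 U \<longleftrightarrow> mat_alpha U * mat_gamma U = 1 \<and> mat_gamma U * mat_alpha U = 1"

definition ID2 :: "'a::ring_1^2^2 \<Rightarrow> bool" where
  "ID2 U \<longleftrightarrow> mat_alpha U * mat_gamma U = mat_gamma U * mat_alpha U"

definition IND1 :: "'a::ring_1^2^2 \<Rightarrow> bool" where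
  "IND1 U \<longleftrightarrow> mat_alpha U * mat_beta U = mat_beta U * mat_gamma U"

definition MD1 :: "('k::field \<Rightarrow> 'a::ring_1 \<Rightarrow> 'a) \<Rightarrow> 'k \<Rightarrow> 'a^2^2 \<Rightarrow> 'a^2^2 \<Rightarrow> bool" where
  "MD1 smul q U V \<longleftrightarrow> mat_alpha U * mat_alpha V = smul q (mat_alpha V * mat_alpha U)"

definition MD2 :: "('k::field \<Rightarrow> 'a::ring_1 \<Rightarrow> 'a) \<Rightarrow> 'k \<Rightarrow> 'a^2^2 \<Rightarrow> 'a^2^2 \<Rightarrow> bool" where
  "MD2 smul q U V \<longleftrightarrow>
     mat_alpha U * mat_alpha V = smul q (mat_alpha V * mat_alpha U) \<and>
     mat_alpha U * mat_gamma V = smul (inverse q) (mat_gamma V * mat_alpha U) \<and>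
     mat_alpha V * mat_gamma U = smul q (mat_gamma U * mat_alpha V) \<and>
     mat_gamma U * mat_gamma V = smul q (mat_gamma V * mat_gamma U)"

definition MND :: "('k::field \<Rightarrow> 'a::ring_1 \<Rightarrow> 'a) \<Rightarrow> 'k \<Rightarrow> 'a^2^2 \<Rightarrow> 'a^2^2 \<Rightarrow> bool" where
  "MND smul q U V \<longleftrightarrow>
     mat_alpha U * mat_beta V = smul q (mat_beta V * mat_gamma U) \<and>
     mat_beta U * mat_gamma V = smul q (mat_alpha V * mat_beta U)"

definition QMP1 :: "('k::field \<Rightarrow> 'a::ring_1 \<Rightarrow> 'a) \<Rightarrow> 'k \<Rightarrow> (('a^2^2) \<times> ('a^2^2)) set" where
  "QMP1 smul q = {(U, V). inv_upper_triangular U \<and> inv_upper_triangular V \<and>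
     ID1 U \<and> ID1 V \<and> IND1 U \<and> IND1 V \<and> MD1 smul q U V \<and> MND smul q U V}"

definition QMP2 :: "('k::field \<Rightarrow> 'a::ring_1 \<Rightarrow> 'a) \<Rightarrow> 'k \<Rightarrow> (('a^2^2) \<times> ('a^2^2)) set" where
  "QMP2 smul q = {(U, V). inv_upper_triangular U \<and> inv_upper_triangular V \<and>
     ID2 U \<and> ID2 V \<and> IND1 U \<and> IND1 V \<and> MD2 smul q U V \<and> MND smul q U V}"

section \<open>The maps S and T\<close>

definition S_map :: "('a::ring_1^2^2) \<times> ('a^2^2) \<Rightarrow> ('a^2^2) \<times> ('a^2^2)" where
  "S_map = (\<lambda>(U, V). (V, matrix_inv U))"

text \<open>The parameter \<open>r\<close> is the chosen square root \<open>q\<^sup>1\<^sup>/\<^sup>2\<close>.\<close>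

definition T1_map ::
  "('k::field \<Rightarrow> 'a::ring_1 \<Rightarrow> 'a) \<Rightarrow> 'k \<Rightarrow> ('a^2^2) \<times> ('a^2^2) \<Rightarrow> ('a^2^2) \<times> ('a^2^2)" where
  "T1_map smul r = (\<lambda>(U, V). (map_matrix (smul (inverse r)) (U ** V), V))"

definition T2_map :: "('a::ring_1^2^2) \<times> ('a^2^2) \<Rightarrow> ('a^2^2) \<times> ('a^2^2)" where
  "T2_map = (\<lambda>(U, V). (U ** V, V))"

section \<open>Representations of the modular group\<close>

definition SL2Z :: "(int^2^2) monoid" where
  "SL2Z = \<lparr>carrier = {A. det A = 1}, mult = (**), one = mat 1\<rparr>"

definition SL2Z_S :: "int^2^2" where
  "SL2Z_S = vector [vector [0, 1], vector [-1, 0]]"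

definition SL2Z_T :: "int^2^2" where
  "SL2Z_T = vector [vector [1, 1], vector [0, 1]]"

text \<open>These two matrices generate \<open>SL2Z\<close>. The sign of \<open>SL2Z_S\<close> is chosen so that
  \<open>(ST)\<^sup>3 = 1\<close>; with the opposite sign the cube would be \<open>-1\<close>.\<close>

lemma SL2Z_generators:
  "SL2Z_S \<in> carrier SL2Z" "SL2Z_T \<in> carrier SL2Z"
  by (simp_all add: SL2Z_def SL2Z_S_def SL2Z_T_def det_2)

lemma SL2Z_relations:
  "SL2Z_S ** SL2Z_S ** SL2Z_S ** SL2Z_S = mat 1"
  "(SL2Z_S ** SL2Z_T) ** (SL2Z_S ** SL2Z_T) ** (SL2Z_S ** SL2Z_T) = mat 1"
  by (simp_all add: SL2Z_S_def SL2Z_T_def vec_eq_iff forall_2 matrix_matrix_mult_def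
      sum_2 mat_def)

text \<open>An action of the group of integer matrices in which the two generators act as
  \<open>S\<close> and \<open>T\<close>.\<close>

definition SL2Z_matrix_rep :: "'x set \<Rightarrow> ('x \<Rightarrow> 'x) \<Rightarrow> ('x \<Rightarrow> 'x) \<Rightarrow> bool" where
  "SL2Z_matrix_rep X S T \<longleftrightarrow>
     (\<exists>\<phi>. group_action SL2Z X \<phi> \<and> (\<forall>x\<in>X. \<phi> SL2Z_S x = S x) \<and> (\<forall>x\<in>X. \<phi> SL2Z_T x = T x))"

text \<open>An action given by generators \<open>S\<close>, \<open>T\<close> and the relations \<open>S\<^sup>4 = (ST)\<^sup>3 = 1\<close>.
  These relations do not imply that \<open>S\<^sup>2\<close> commutes with \<open>T\<close>, which holds in the matrix group;
  so this is weaker than \<open>SL2Z_matrix_rep\<close>.\<close>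

definition modular_presentation_rep :: "'x set \<Rightarrow> ('x \<Rightarrow> 'x) \<Rightarrow> ('x \<Rightarrow> 'x) \<Rightarrow> bool" where
  "modular_presentation_rep X S T \<longleftrightarrow>
     bij_betw S X X \<and> bij_betw T X X \<and>
     (\<forall>x\<in>X. (S ^^ 4) x = x) \<and> (\<forall>x\<in>X. ((S \<circ> T) ^^ 3) x = x)"

end

theory Submission
  imports Defs
begin

text \<open>
  For pairs of type I the action can be written down for all of \<open>SL(2,\<int>)\<close> at once.
  With \<open>r\<^sup>2 = q\<close>, put \<open>W(a,b) = r\<^bsup>-ab\<^esup> U\<^sub>1\<^sup>a U\<^sub>2\<^sup>b\<close>. Since \<open>U\<^sub>1U\<^sub>2 = qU\<^sub>2U\<^sub>1\<close>, these Weyl-ordered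
  monomials satisfy \<open>W(v) W(w) = r\<^bsup>\<omega>(v,w)\<^esup> W(v + w)\<close>, where \<open>\<omega>\<close> is the determinant form on \<open>\<int>\<^sup>2\<close>
  (\<open>weyl_mult\<close>). A matrix \<open>A\<close> acts by sending the pair to \<open>(W(row\<^sub>1 A), W(row\<^sub>2 A))\<close>. Since \<open>SL(2,\<int>)\<close>
  preserves \<open>\<omega>\<close>, the new pair multiplies in the same way as the old one; so forming monomials in
  it amounts to multiplying row vectors of exponents by \<open>A\<close> (\<open>weyl_weyl\<close>), and this is an
  action. The relations \<open>S\<^sup>4 = (ST)\<^sup>3 = 1\<close> are then inherited from the two integer matrices, whose
  rows give exactly \<open>S\<close> and \<open>T\<close>; the factor \<open>q\<^bsup>-1/2\<^esup>\<close> in \<open>T\<close> is \<open>r\<^bsup>-ab\<^esup>\<close> at \<open>a = b = 1\<close>.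

  It remains to see that quantum matrix pairs go to quantum matrix pairs. Taking the diagonal
  part \<open>D(U) = diag(\<alpha>,\<gamma>)\<close>, or the swapped one \<open>D'(U) = diag(\<gamma>,\<alpha>)\<close>, is an endomorphism of the
  group of invertible upper triangular matrices, and the defining relations say that
  \<open>D(U\<^sub>i) U\<^sub>j = q\<^bsup>\<omega>(i,j)\<^esup> U\<^sub>j D(U\<^sub>i)\<close> for all \<open>i, j\<close>, together with \<open>D'(U\<^sub>i) = D(U\<^sub>i)\<^sup>-\<^sup>1\<close> in type I
  and with \<open>D'(U\<^sub>i) D(U\<^sub>j) = q\<^bsup>-\<omega>(i,j)\<^esup> D(U\<^sub>j) D'(U\<^sub>i)\<close> in type II (\<open>QMP1_iff\<close>, \<open>QMP2_iff\<close>). Here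
  \<open>\<omega>(1,2) = 1 = -\<omega>(2,1)\<close> and \<open>\<omega>(i,i) = 0\<close>. Commutation up to a central factor is multiplicative in
  both arguments, so all these relations pass to monomials, and again only \<open>\<omega>\<close> enters.

  For type II the same description shows that \<open>S\<close> and \<open>T\<close> preserve the space. The identities
  \<open>S\<^sup>4 = 1\<close> and \<open>(ST)\<^sup>3 = 1\<close> hold for any two elements of any group, because \<open>ST\<close> sends \<open>(U,V)\<close> to
  \<open>(V,(UV)\<^sup>-\<^sup>1)\<close>: it shifts a triple of elements with product \<open>UV(UV)\<^sup>-\<^sup>1 = 1\<close> cyclically.
\<close>

section \<open>Commutation up to a central factor\<close>

definition central_elem :: "('g, 'm) monoid_scheme \<Rightarrow> 'g \<Rightarrow> bool" where
  "central_elem G c \<longleftrightarrow> c \<in> carrier G \<and> (\<forall>x\<in>carrier G. c \<otimes>\<^bsub>G\<^esub> x = x \<otimes>\<^bsub>G\<^esub> c)"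

definition q_commute :: "('g, 'm) monoid_scheme \<Rightarrow> 'g \<Rightarrow> 'g \<Rightarrow> 'g \<Rightarrow> bool" where
  "q_commute G c x y \<longleftrightarrow> x \<otimes>\<^bsub>G\<^esub> y = c \<otimes>\<^bsub>G\<^esub> (y \<otimes>\<^bsub>G\<^esub> x)"

text \<open>With \<open>\<omega>\<close> the determinant form on \<open>\<int>\<^sup>2\<close>, the \<open>i\<close>-th element of the first pair and the \<open>j\<close>-th of
  the second commute up to \<open>c\<close> to the power \<open>\<omega>(i,j)\<close>. Replacing both pairs by monomials in them,
  with the rows of one matrix of determinant \<open>1\<close> as exponents, preserves this.\<close>

definition cross_commute :: "('g, 'm) monoid_scheme \<Rightarrow> 'g \<Rightarrow> 'g \<times> 'g \<Rightarrow> 'g \<times> 'g \<Rightarrow> bool" where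
  "cross_commute G c = (\<lambda>(u, v) (x, y).
     q_commute G \<one>\<^bsub>G\<^esub> u x \<and> q_commute G \<one>\<^bsub>G\<^esub> v y \<and>
     q_commute G c u y \<and> q_commute G (inv\<^bsub>G\<^esub> c) v x)"

text \<open>The Weyl ordering of \<open>u\<^sup>a v\<^sup>b\<close>. When \<open>uv = z\<^sup>2vu\<close> with \<open>z\<close> central, the factor \<open>z\<^bsup>-ab\<^esup>\<close> treats both
  orders alike: \<open>z\<^bsup>-ab\<^esup> u\<^sup>a v\<^sup>b = z\<^bsup>ab\<^esup> v\<^sup>b u\<^sup>a\<close>.\<close>

definition weyl :: "('g, 'm) monoid_scheme \<Rightarrow> 'g \<Rightarrow> 'g \<times> 'g \<Rightarrow> int \<Rightarrow> int \<Rightarrow> 'g" where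
  "weyl G z = (\<lambda>(u, v) a b.
     z [^]\<^bsub>G\<^esub> (- (a * b)) \<otimes>\<^bsub>G\<^esub> (u [^]\<^bsub>G\<^esub> a \<otimes>\<^bsub>G\<^esub> v [^]\<^bsub>G\<^esub> b))"

context group
begin

lemma mult_inv_mult_cancel:
  assumes "x \<in> carrier G" "y \<in> carrier G"
  shows "y \<otimes> inv (x \<otimes> y) = inv x" "inv (x \<otimes> y) \<otimes> x = inv y"
proof -
  show "y \<otimes> inv (x \<otimes> y) = inv x"
    using assms by (simp add: inv_mult_group flip: m_assoc)
  show "inv (x \<otimes> y) \<otimes> x = inv y"
    using assms by (simp add: inv_mult_group m_assoc)
qed

lemma central_elem_closed: "central_elem G c \<Longrightarrow> c \<in> carrier G"
  by (simp add: central_elem_def)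

lemma central_elem_lcomm:
  assumes "central_elem G c" "x \<in> carrier G" "y \<in> carrier G"
  shows "x \<otimes> (c \<otimes> y) = c \<otimes> (x \<otimes> y)"
  using assms by (metis central_elem_def m_assoc)

lemma central_elem_one: "central_elem G \<one>"
  by (simp add: central_elem_def)

lemma central_elem_mult:
  assumes "central_elem G c" "central_elem G d"
  shows "central_elem G (c \<otimes> d)"
  using assms by (smt (verit) central_elem_def m_assoc m_closed)

lemma central_elem_inv:
  assumes "central_elem G c"
  shows "central_elem G (inv c)"
  using assms by (smt (verit) central_elem_def inv_closed inv_solve_left inv_solve_right m_assoc m_closed)

lemma central_elem_int_pow:
  assumes "central_elem G c"
  shows "central_elem G (c [^] (n::int))"
proof -
  have c: "c \<in> carrier G" using assms by (rule central_elem_closed)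
  have nat: "central_elem G (c [^] m)" for m :: nat
    by (induction m) (simp_all add: central_elem_one central_elem_mult assms)
  show ?thesis
    using nat central_elem_inv[OF nat] c
    by (cases n rule: int_cases2) (simp_all add: int_pow_int int_pow_neg)
qed

text \<open>Commutation up to a central factor is multiplicative in each argument, as commutators are when
  they are central. Everything below about monomials follows from this.\<close>

lemma q_commute_mult_right:
  assumes "q_commute G c x y" "q_commute G d x y'"
    and "central_elem G c" "central_elem G d"
    and [simp]: "x \<in> carrier G" "y \<in> carrier G" "y' \<in> carrier G"
  shows "q_commute G (c \<otimes> d) x (y \<otimes> y')"
proof -
  have [simp]: "c \<in> carrier G" "d \<in> carrier G"
    using assms(3,4) by (simp_all add: central_elem_closed)
  have "x \<otimes> (y \<otimes> y') = (c \<otimes> (y \<otimes> x)) \<otimes> y'"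
    using assms(1) by (simp add: q_commute_def flip: m_assoc)
  also have "\<dots> = c \<otimes> (y \<otimes> (d \<otimes> (y' \<otimes> x)))"
    using assms(2) by (simp add: q_commute_def m_assoc)
  also have "\<dots> = (c \<otimes> d) \<otimes> ((y \<otimes> y') \<otimes> x)"
    using central_elem_lcomm[OF assms(4)] by (simp add: m_assoc)
  finally show ?thesis by (simp add: q_commute_def)
qed

lemma q_commute_swap:
  assumes "q_commute G c x y" "c \<in> carrier G" "x \<in> carrier G" "y \<in> carrier G"
  shows "q_commute G (inv c) y x"
  using assms by (simp add: q_commute_def inv_solve_left)

lemma q_commute_mult_left:
  assumes "q_commute G c x y" "q_commute G d x' y"
    and "central_elem G c" "central_elem G d"
    and "x \<in> carrier G" "x' \<in> carrier G" "y \<in> carrier G"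
  shows "q_commute G (c \<otimes> d) (x \<otimes> x') y"
proof -
  have cd: "c \<in> carrier G" "d \<in> carrier G"
    using assms(3,4) by (simp_all add: central_elem_closed)
  have "q_commute G (inv c \<otimes> inv d) y (x \<otimes> x')"
    by (intro q_commute_mult_right q_commute_swap central_elem_inv assms cd)
  then have "q_commute G (inv (inv c \<otimes> inv d)) (x \<otimes> x') y"
    using assms cd by (intro q_commute_swap) auto
  then show ?thesis
    using cd assms(3) by (simp add: inv_mult_group central_elem_def)
qed

lemma q_commute_inv_right:
  assumes "q_commute G c x y" "central_elem G c" "x \<in> carrier G" "y \<in> carrier G"
  shows "q_commute G (inv c) x (inv y)"
proof -
  note c = central_elem_closed[OF assms(2)]
  have "inv c \<otimes> (inv y \<otimes> x) = inv y \<otimes> (inv c \<otimes> (x \<otimes> y)) \<otimes> inv y"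
    using assms c central_elem_lcomm[OF central_elem_inv[OF assms(2)]] by (simp add: m_assoc)
  also have "inv c \<otimes> (x \<otimes> y) = y \<otimes> x"
    using assms c by (simp add: q_commute_def flip: m_assoc)
  also have "inv y \<otimes> (y \<otimes> x) \<otimes> inv y = x \<otimes> inv y"
    using assms by (simp flip: m_assoc)
  finally show ?thesis by (simp add: q_commute_def)
qed

lemma q_commute_inv_left:
  assumes "q_commute G c x y" "central_elem G c" "x \<in> carrier G" "y \<in> carrier G"
  shows "q_commute G (inv c) (inv x) y"
  using q_commute_swap[OF q_commute_inv_right[OF q_commute_swap[OF assms(1)]]] assms
  by (simp add: central_elem_inv central_elem_closed)

lemma q_commute_int_pow_right:
  assumes "q_commute G c x y" "central_elem G c" "x \<in> carrier G" "y \<in> carrier G"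
  shows "q_commute G (c [^] (n::int)) x (y [^] n)"
proof -
  note c = central_elem_closed[OF assms(2)]
  have central: "central_elem G (c [^] m)" for m :: nat
    using central_elem_int_pow[OF assms(2), of "int m"] by (simp add: int_pow_int)
  have nat: "q_commute G (c [^] m) x (y [^] m)" for m :: nat
  proof (induction m)
    case 0
    show ?case using assms by (simp add: q_commute_def)
  next
    case (Suc m)
    then show ?case
      using q_commute_mult_right[OF _ assms(1) central assms(2)] assms by simp
  qed
  show ?thesis
    using nat q_commute_inv_right[OF nat central] assms c
    by (cases n rule: int_cases2) (simp_all add: int_pow_int int_pow_neg)
qed

lemma q_commute_int_pow:
  assumes "q_commute G c x y" "central_elem G c" "x \<in> carrier G" "y \<in> carrier G"
  shows "q_commute G (c [^] (m * n)) (x [^] (m::int)) (y [^] (n::int))"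
proof -
  note c = central_elem_closed[OF assms(2)]
  have "q_commute G (inv (inv c [^] m)) (x [^] m) y"
    using assms c
    by (intro q_commute_swap q_commute_int_pow_right central_elem_inv) auto
  then have "q_commute G (c [^] m) (x [^] m) y"
    using c by (simp add: int_pow_inv)
  from q_commute_int_pow_right[OF this, of n] show ?thesis
    using assms c by (simp add: central_elem_int_pow int_pow_pow)
qed

lemma q_commute_central_left:
  assumes "central_elem G z" "q_commute G c x y" "central_elem G c" "x \<in> carrier G" "y \<in> carrier G"
  shows "q_commute G c (z \<otimes> x) y"
proof -
  have "q_commute G (\<one> \<otimes> c) (z \<otimes> x) y"
    using assms by (intro q_commute_mult_left central_elem_one) (auto simp: q_commute_def central_elem_def)
  then show ?thesis using assms by (simp add: central_elem_closed)
qed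

lemma q_commute_central_right:
  assumes "central_elem G z" "q_commute G c x y" "central_elem G c" "x \<in> carrier G" "y \<in> carrier G"
  shows "q_commute G c x (z \<otimes> y)"
proof -
  have "q_commute G (\<one> \<otimes> c) x (z \<otimes> y)"
    using assms by (intro q_commute_mult_right central_elem_one) (auto simp: q_commute_def central_elem_def)
  then show ?thesis using assms by (simp add: central_elem_closed)
qed

lemma weyl_closed [simp]:
  assumes "z \<in> carrier G" "u \<in> carrier G" "v \<in> carrier G"
  shows "weyl G z (u, v) a b \<in> carrier G"
  using assms by (simp add: weyl_def)

lemma weyl_basis [simp]:
  assumes "z \<in> carrier G" "u \<in> carrier G" "v \<in> carrier G"
  shows "weyl G z (u, v) 1 0 = u" "weyl G z (u, v) 0 1 = v" "weyl G z (u, v) 0 0 = \<one>"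
  using assms by (simp_all add: weyl_def)

text \<open>Moving \<open>v\<^sup>b\<close> past \<open>u\<^sup>c\<close> costs \<open>z\<^bsup>-2bc\<^esup>\<close>; the Weyl factors turn this into the antisymmetric exponent
  \<open>ad - bc\<close>.\<close>

lemma weyl_mult:
  assumes z: "central_elem G z" and uv: "q_commute G (z \<otimes> z) u v"
    and [simp]: "u \<in> carrier G" "v \<in> carrier G"
  shows "weyl G z (u, v) a b \<otimes> weyl G z (u, v) c d =
    z [^] (a * d - b * c) \<otimes> weyl G z (u, v) (a + c) (b + d)"
proof -
  have [simp]: "z \<in> carrier G" using z by (rule central_elem_closed)
  have zz: "(z \<otimes> z) [^] (n::int) = z [^] (2 * n)" for n
    unfolding mult_2 by (simp only: int_pow_mult_distrib int_pow_mult \<open>z \<in> carrier G\<close>)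
  have "q_commute G (inv (z \<otimes> z) [^] (b * c)) (v [^] b) (u [^] c)"
    using z uv by (intro q_commute_int_pow q_commute_swap central_elem_inv central_elem_mult) auto
  then have vu: "v [^] b \<otimes> u [^] c = z [^] (- (2 * (b * c))) \<otimes> (u [^] c \<otimes> v [^] b)"
    by (simp add: q_commute_def int_pow_inv zz int_pow_neg)
  have lc: "u [^] a \<otimes> (z [^] n \<otimes> y) = z [^] n \<otimes> (u [^] a \<otimes> y)"
    "v [^] b \<otimes> (z [^] n \<otimes> y) = z [^] n \<otimes> (v [^] b \<otimes> y)"
    if "y \<in> carrier G" for n :: int and y
    using that by (simp_all add: central_elem_lcomm[OF central_elem_int_pow[OF z]])
  have "weyl G z (u, v) a b \<otimes> weyl G z (u, v) c d =
     z [^] (- (a * b)) \<otimes> (u [^] a \<otimes> (v [^] b \<otimes> (z [^] (- (c * d)) \<otimes> (u [^] c \<otimes> v [^] d))))"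
    by (simp add: weyl_def m_assoc)
  also have "\<dots> = z [^] (- (a * b)) \<otimes> (z [^] (- (c * d)) \<otimes> (u [^] a \<otimes> ((v [^] b \<otimes> u [^] c) \<otimes> v [^] d)))"
    by (simp add: lc m_assoc)
  also have "u [^] a \<otimes> ((v [^] b \<otimes> u [^] c) \<otimes> v [^] d) =
      z [^] (- (2 * (b * c))) \<otimes> (u [^] a \<otimes> ((u [^] c \<otimes> v [^] b) \<otimes> v [^] d))"
    by (simp add: vu lc m_assoc)
  also have "u [^] a \<otimes> ((u [^] c \<otimes> v [^] b) \<otimes> v [^] d) = u [^] (a + c) \<otimes> v [^] (b + d)"
    by (simp add: int_pow_mult m_assoc)
  also have "z [^] (- (a * b)) \<otimes> (z [^] (- (c * d)) \<otimes> (z [^] (- (2 * (b * c))) \<otimes> (u [^] (a + c) \<otimes> v [^] (b + d)))) =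
      z [^] (- (a * b) + (- (c * d)) + - (2 * (b * c))) \<otimes> (u [^] (a + c) \<otimes> v [^] (b + d))"
    by (simp only: int_pow_mult m_assoc int_pow_closed m_closed \<open>z \<in> carrier G\<close> \<open>u \<in> carrier G\<close> \<open>v \<in> carrier G\<close>)
  also have "- (a * b) + (- (c * d)) + - (2 * (b * c)) = (a * d - b * c) + - ((a + c) * (b + d))"
    by (simp add: algebra_simps)
  finally show ?thesis
    unfolding weyl_def by (simp only: int_pow_mult m_assoc int_pow_closed m_closed prod.case
        \<open>z \<in> carrier G\<close> \<open>u \<in> carrier G\<close> \<open>v \<in> carrier G\<close>)
qed

text \<open>The exponent in \<open>weyl_mult\<close> vanishes for parallel vectors, so multiples of one
  vector multiply without a central factor. The same reason gives \<open>weyl_int_pow\<close>.\<close>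

lemma weyl_inverse:
  assumes z: "central_elem G z" and uv: "q_commute G (z \<otimes> z) u v"
    and u: "u \<in> carrier G" and v: "v \<in> carrier G"
  shows "inv (weyl G z (u, v) a b) = weyl G z (u, v) (- a) (- b)"
  using weyl_mult[OF assms, of "- a" "- b" a b] central_elem_closed[OF z] u v
  by (simp add: inv_equality)

lemma weyl_of_inverses:
  assumes "u \<in> carrier G" "v \<in> carrier G"
  shows "weyl G z (inv u, inv v) a b = weyl G z (u, v) (- a) (- b)"
  using assms by (simp add: weyl_def int_pow_inv int_pow_neg)

lemma weyl_int_pow:
  assumes z: "central_elem G z" and uv: "q_commute G (z \<otimes> z) u v"
    and u: "u \<in> carrier G" and v: "v \<in> carrier G"
  shows "weyl G z (u, v) a b [^] (n::int) = weyl G z (u, v) (n * a) (n * b)"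
proof -
  note zc = central_elem_closed[OF z]
  have nat: "weyl G z (u, v) a b [^] m = weyl G z (u, v) (int m * a) (int m * b)" for m :: nat
  proof (induction m)
    case (Suc m)
    then show ?case
      using weyl_mult[OF assms, of "int m * a" "int m * b" a b] zc u v
      by (simp add: algebra_simps)
  qed (use zc u v in simp)
  show ?thesis
    using nat weyl_inverse[OF assms] zc u v by (cases n rule: int_cases2) (simp_all add: int_pow_int int_pow_neg)
qed

text \<open>Substitution of monomials is multiplication of exponent matrices. The factor \<open>z\<^bsup>-mn\<^esup>\<close> in front
  cancels against the one that \<open>weyl_mult\<close> produces exactly because the determinant is \<open>1\<close>.\<close>

lemma weyl_weyl:
  assumes z: "central_elem G z" and uv: "q_commute G (z \<otimes> z) u v"
    and u: "u \<in> carrier G" and v: "v \<in> carrier G" and det: "a * d - b * c = 1"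
  shows "weyl G z (weyl G z (u, v) a b, weyl G z (u, v) c d) m n =
    weyl G z (u, v) (m * a + n * c) (m * b + n * d)"
proof -
  note zc [simp] = central_elem_closed[OF z]
  have "weyl G z (weyl G z (u, v) a b, weyl G z (u, v) c d) m n =
      z [^] (- (m * n)) \<otimes> (weyl G z (u, v) (m * a) (m * b) \<otimes> weyl G z (u, v) (n * c) (n * d))"
    by (subst weyl_def) (simp add: weyl_int_pow[OF z uv u v])
  also have "\<dots> = z [^] (- (m * n) + (m * a * (n * d) - m * b * (n * c))) \<otimes>
      weyl G z (u, v) (m * a + n * c) (m * b + n * d)"
    using u v by (simp only: weyl_mult[OF z uv u v] int_pow_mult m_assoc weyl_closed int_pow_closed zc)
  also have "m * a * (n * d) - m * b * (n * c) = m * n * (a * d - b * c)"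
    by (simp add: algebra_simps)
  finally show ?thesis using det u v by simp
qed

text \<open>The bilinear extension of a cross commutation from generators to monomials. The central
  prefactors \<open>z\<close> and \<open>w\<close> may differ, as they commute with everything.\<close>

lemma weyl_q_commute:
  assumes z: "central_elem G z" and w: "central_elem G w" and s: "central_elem G s"
    and carr [simp]: "u \<in> carrier G" "v \<in> carrier G" "x \<in> carrier G" "y \<in> carrier G"
    and cross: "cross_commute G s (u, v) (x, y)"
  shows "q_commute G (s [^] (a * d - b * c)) (weyl G z (u, v) a b) (weyl G w (x, y) c d)"
proof -
  note sc [simp] = central_elem_closed[OF s]
  note zc [simp] = central_elem_closed[OF z]
  note wc [simp] = central_elem_closed[OF w]
  have cpow: "central_elem G (s [^] (n::int))" for n by (rule central_elem_int_pow[OF s])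
  have ux: "q_commute G (s [^] (0::int)) (u [^] a) (x [^] c)"
    using q_commute_int_pow[of \<one> u x a c] cross by (simp add: cross_commute_def central_elem_one)
  have uy: "q_commute G (s [^] (a * d)) (u [^] a) (y [^] d)"
    using q_commute_int_pow[of s u y a d] cross s by (simp add: cross_commute_def)
  have vx: "q_commute G (s [^] (- (b * c))) (v [^] b) (x [^] c)"
    using q_commute_int_pow[of "inv s" v x b c] cross s central_elem_inv[OF s]
    by (simp add: cross_commute_def int_pow_neg int_pow_inv)
  have vy: "q_commute G (s [^] (0::int)) (v [^] b) (y [^] d)"
    using q_commute_int_pow[of \<one> v y b d] cross by (simp add: cross_commute_def central_elem_one)
  have "q_commute G (s [^] (a * d - b * c)) (u [^] a \<otimes> v [^] b) (x [^] c \<otimes> y [^] d)"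
    using q_commute_mult_left[OF q_commute_mult_right[OF ux uy cpow cpow]
        q_commute_mult_right[OF vx vy cpow cpow]]
    by (simp add: central_elem_mult cpow flip: int_pow_mult)
  then show ?thesis
    unfolding weyl_def using z w cpow
    by (simp add: q_commute_central_left q_commute_central_right central_elem_int_pow)
qed

lemma cross_commute_S:
  assumes "cross_commute G s (u, v) (x, y)" "central_elem G s"
    and "u \<in> carrier G" "v \<in> carrier G" "x \<in> carrier G" "y \<in> carrier G"
  shows "cross_commute G s (v, inv u) (y, inv x)"
  using assms q_commute_inv_right[of "inv s" v x] q_commute_inv_left[of s u y]
    q_commute_inv_right[of "inv \<one>" "inv u" x] q_commute_inv_left[of \<one> u x]
  by (simp add: cross_commute_def central_elem_inv central_elem_one central_elem_closed)

lemma cross_commute_T: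
  assumes "cross_commute G s (u, v) (x, y)" and s: "central_elem G s"
    and "u \<in> carrier G" "v \<in> carrier G" "x \<in> carrier G" "y \<in> carrier G"
  shows "cross_commute G s (u \<otimes> v, v) (x \<otimes> y, y)"
proof -
  note c = central_elem_closed[OF s] central_elem_one s central_elem_inv[OF s]
  have ux: "q_commute G s u (x \<otimes> y)"
    using assms c q_commute_mult_right[of \<one> u x s y] by (simp add: cross_commute_def)
  have vx: "q_commute G (inv s) v (x \<otimes> y)"
    using assms c q_commute_mult_right[of "inv s" v x \<one> y] by (simp add: cross_commute_def)
  show ?thesis
    using assms c vx q_commute_mult_left[OF ux vx] q_commute_mult_left[of s u y \<one> v]
    by (simp add: cross_commute_def)
qed

end

lemma weyl_hom:
  assumes "h \<in> hom G H" "group G" "group H"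
    and "z \<in> carrier G" "u \<in> carrier G" "v \<in> carrier G"
  shows "h (weyl G z (u, v) a b) = weyl H (h z) (h u, h v) a b"
proof -
  interpret group_hom G H h by (intro group_hom.intro group_hom_axioms.intro assms)
  show ?thesis using assms by (simp add: weyl_def hom_int_pow)
qed

section \<open>Quantum matrix pairs in the group of triangular matrices\<close>

lemma matrix_2_eq_iff:
  "A = B \<longleftrightarrow> A$1$1 = B$1$1 \<and> A$1$2 = B$1$2 \<and> A$2$1 = B$2$1 \<and> A$2$2 = B$2$2"
  for A B :: "'a^2^2"
  by (auto simp: vec_eq_iff forall_2)

lemma matrix_2_mult_nth:
  "(A ** B) $ i $ j = A$i$1 * B$1$j + A$i$2 * B$2$j" for A B :: "'a::semiring_1^2^2"
  by (simp add: matrix_matrix_mult_def sum_2)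

lemma mat_2_nth:
  "(mat c :: 'a::zero^2^2) $ 1 $ 1 = c" "(mat c :: 'a^2^2) $ 1 $ 2 = 0"
  "(mat c :: 'a^2^2) $ 2 $ 1 = 0" "(mat c :: 'a^2^2) $ 2 $ 2 = c"
  by (simp_all add: mat_def)

lemma invertible_elem_one: "invertible_elem 1"
  by (auto simp: invertible_elem_def)

lemma invertible_elem_mult:
  assumes "invertible_elem a" "invertible_elem b"
  shows "invertible_elem (a * b)"
proof -
  obtain a' b' where "a * a' = 1" "a' * a = 1" "b * b' = 1" "b' * b = 1"
    using assms by (auto simp: invertible_elem_def)
  then have "a * b * (b' * a') = 1" "b' * a' * (a * b) = 1"
    by (metis mult.assoc mult_1_right)+
  then show ?thesis by (auto simp: invertible_elem_def)
qed

text \<open>All elements occurring in the two maps lie in this group, so that inverses and integer powers are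
  those of a group.\<close>

definition upper_group :: "('a::ring_1^2^2) monoid" where
  "upper_group = \<lparr>carrier = {U. inv_upper_triangular U}, mult = (**), one = mat 1\<rparr>"

lemma upper_group_simps [simp]:
  "U \<in> carrier upper_group \<longleftrightarrow> inv_upper_triangular U"
  "U \<otimes>\<^bsub>upper_group\<^esub> V = U ** V"
  "\<one>\<^bsub>upper_group\<^esub> = mat 1"
  by (simp_all add: upper_group_def)

lemma inv_upper_triangular_left_inverse:
  assumes "inv_upper_triangular U"
  shows "\<exists>V. inv_upper_triangular V \<and> V ** U = mat 1"
proof -
  obtain a d where a: "mat_alpha U * a = 1" "a * mat_alpha U = 1"
    and d: "mat_gamma U * d = 1" "d * mat_gamma U = 1"
    using assms by (auto simp: inv_upper_triangular_def invertible_elem_def)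
  define V :: "'a^2^2" where "V = vector [vector [a, - (a * mat_beta U * d)], vector [0, d]]"
  have "V ** U = mat 1"
    using assms a d
    by (simp add: V_def matrix_2_eq_iff matrix_2_mult_nth mat_2_nth inv_upper_triangular_def mult.assoc)
  moreover have "inv_upper_triangular V"
    using a d by (auto simp: V_def inv_upper_triangular_def invertible_elem_def)
  ultimately show ?thesis by blast
qed

lemma group_upper_group: "group (upper_group :: ('a::ring_1^2^2) monoid)"
proof (rule groupI)
  fix U V :: "'a^2^2"
  assume "U \<in> carrier upper_group" "V \<in> carrier upper_group"
  then show "U \<otimes>\<^bsub>upper_group\<^esub> V \<in> carrier upper_group"
    by (simp add: inv_upper_triangular_def matrix_2_mult_nth invertible_elem_mult)
next
  show "\<one>\<^bsub>upper_group\<^esub> \<in> (carrier upper_group :: ('a^2^2) set)"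
    by (simp add: inv_upper_triangular_def mat_2_nth invertible_elem_one)
qed (auto simp: matrix_mul_assoc Bex_def inv_upper_triangular_left_inverse)

interpretation upper: group "upper_group :: ('a::ring_1^2^2) monoid"
  by (rule group_upper_group)

lemma upper_inv_eq_matrix_inv:
  assumes "inv_upper_triangular U"
  shows "inv\<^bsub>upper_group\<^esub> U = matrix_inv U"
proof -
  let ?V = "inv\<^bsub>upper_group\<^esub> U"
  have V: "U ** ?V = mat 1" "?V ** U = mat 1"
    using upper.r_inv[of U] upper.l_inv[of U] assms by simp_all
  then have "\<exists>W. U ** W = mat 1 \<and> W ** U = mat 1"
    by blast
  then have "U ** matrix_inv U = mat 1"
    unfolding matrix_inv_def by (metis (mono_tags, lifting) someI_ex)
  then have "?V = ?V ** (U ** matrix_inv U)"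
    by simp
  also have "\<dots> = matrix_inv U"
    by (simp only: matrix_mul_assoc V matrix_mul_lid)
  finally show ?thesis .
qed

lemma inv_upper_triangular_mult:
  assumes "inv_upper_triangular U" "inv_upper_triangular V"
  shows "inv_upper_triangular (U ** V)"
  using upper.m_closed[of U V] assms by simp

lemma inv_upper_triangular_inv:
  assumes "inv_upper_triangular U"
  shows "inv_upper_triangular (inv\<^bsub>upper_group\<^esub> U)"
  using upper.inv_closed[of U] assms by simp

lemma S_map_eq_inv:
  assumes "inv_upper_triangular U"
  shows "S_map (U, V) = (V, inv\<^bsub>upper_group\<^esub> U)"
  using assms by (simp add: S_map_def upper_inv_eq_matrix_inv)

definition diag_part :: "'a::ring_1^2^2 \<Rightarrow> 'a^2^2" where
  "diag_part U = vector [vector [mat_alpha U, 0], vector [0, mat_gamma U]]"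

definition diag_swap :: "'a::ring_1^2^2 \<Rightarrow> 'a^2^2" where
  "diag_swap U = vector [vector [mat_gamma U, 0], vector [0, mat_alpha U]]"

lemma diag_nth [simp]:
  "diag_part U $ 1 $ 1 = mat_alpha U" "diag_part U $ 1 $ 2 = 0"
  "diag_part U $ 2 $ 1 = 0" "diag_part U $ 2 $ 2 = mat_gamma U"
  "diag_swap U $ 1 $ 1 = mat_gamma U" "diag_swap U $ 1 $ 2 = 0"
  "diag_swap U $ 2 $ 1 = 0" "diag_swap U $ 2 $ 2 = mat_alpha U"
  by (simp_all add: diag_part_def diag_swap_def)

lemma inv_upper_triangular_diag [simp]:
  assumes "inv_upper_triangular U"
  shows "inv_upper_triangular (diag_part U)" "inv_upper_triangular (diag_swap U)"
  using assms by (simp_all add: inv_upper_triangular_def)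

text \<open>For triangular matrices the diagonal of a product is the product of the diagonals. This is what
  lets the relations pass from a pair to its monomials.\<close>

lemma diag_part_hom: "diag_part \<in> hom upper_group upper_group"
  by (auto simp: hom_def matrix_2_eq_iff matrix_2_mult_nth inv_upper_triangular_def)

lemma diag_swap_hom: "diag_swap \<in> hom upper_group upper_group"
  by (auto simp: hom_def matrix_2_eq_iff matrix_2_mult_nth inv_upper_triangular_def)

lemma ID1_iff:
  assumes "inv_upper_triangular U"
  shows "ID1 U \<longleftrightarrow> diag_swap U = inv\<^bsub>upper_group\<^esub> (diag_part U)"
proof -
  have "diag_swap U = inv\<^bsub>upper_group\<^esub> (diag_part U) \<longleftrightarrow> diag_swap U ** diag_part U = mat 1"
    using assms upper.inv_equality[of "diag_swap U" "diag_part U"] upper.l_inv[of "diag_part U"]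
    by auto
  then show ?thesis
    by (auto simp: ID1_def matrix_2_eq_iff matrix_2_mult_nth mat_2_nth)
qed

definition scalar_mat :: "('k \<Rightarrow> 'a::ring_1 \<Rightarrow> 'a) \<Rightarrow> 'k \<Rightarrow> 'a^2^2" where
  "scalar_mat smul c = mat (smul c 1)"

context algebra_over_field
begin

lemma smul_one_mult [simp]: "smul c 1 * x = smul c x" "x * smul c 1 = smul c x"
  by (simp_all add: smul_mult_left smul_mult_right)

lemma scalar_mat_mult_left: "scalar_mat smul c ** U = map_matrix (smul c) U" for U :: "_^2^2"
  by (simp add: scalar_mat_def matrix_2_eq_iff matrix_2_mult_nth mat_2_nth)

lemma scalar_mat_one: "scalar_mat smul 1 = mat 1"
  by (simp add: scalar_mat_def)

lemma scalar_mat_mult: "scalar_mat smul c ** scalar_mat smul d = scalar_mat smul (c * d)"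
  by (simp add: scalar_mat_def matrix_2_eq_iff matrix_2_mult_nth mat_2_nth)

lemma central_scalar_mat:
  assumes "c \<noteq> 0"
  shows "central_elem upper_group (scalar_mat smul c)"
proof -
  have "smul c 1 * smul (inverse c) 1 = 1" "smul (inverse c) 1 * smul c 1 = 1"
    using assms by simp_all
  then have "invertible_elem (smul c 1)"
    unfolding invertible_elem_def by blast
  then have "inv_upper_triangular (scalar_mat smul c)"
    by (simp add: inv_upper_triangular_def scalar_mat_def mat_2_nth)
  then show ?thesis
    by (simp add: central_elem_def scalar_mat_def matrix_2_eq_iff matrix_2_mult_nth mat_2_nth)
qed

lemma scalar_mat_closed: "c \<noteq> 0 \<Longrightarrow> inv_upper_triangular (scalar_mat smul c)"
  using upper.central_elem_closed[OF central_scalar_mat] by simp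

lemma inv_scalar_mat:
  assumes "c \<noteq> 0"
  shows "inv\<^bsub>upper_group\<^esub> (scalar_mat smul c) = scalar_mat smul (inverse c)"
proof (rule upper.inv_equality)
  show "scalar_mat smul (inverse c) \<otimes>\<^bsub>upper_group\<^esub> scalar_mat smul c = \<one>\<^bsub>upper_group\<^esub>"
    using assms by (simp add: scalar_mat_mult scalar_mat_one)
qed (use assms in \<open>simp_all add: scalar_mat_closed\<close>)

lemma diag_scalar_mat [simp]:
  "diag_part (scalar_mat smul c) = scalar_mat smul c"
  "diag_swap (scalar_mat smul c) = scalar_mat smul c"
  by (simp_all add: matrix_2_eq_iff scalar_mat_def mat_2_nth)

lemma q_commute_upper_iff:
  "q_commute upper_group (scalar_mat smul c) U V \<longleftrightarrow> U ** V = map_matrix (smul c) (V ** U)"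
  by (simp add: q_commute_def scalar_mat_mult_left)

lemma q_commute_upper_one_iff: "q_commute upper_group (mat 1) U V \<longleftrightarrow> U ** V = V ** U"
  by (simp add: q_commute_def)

lemma smul_eq_inverse_iff:
  assumes "c \<noteq> 0"
  shows "x = smul (inverse c) y \<longleftrightarrow> y = smul c x"
proof -
  have "smul c (smul (inverse c) y) = y" "smul (inverse c) (smul c x) = x"
    using assms by simp_all
  then show ?thesis by metis
qed

text \<open>A full matrix relation \<open>UV = qVU\<close> only constrains the sum of the two terms in the upper right
  entry. Replacing one factor by its diagonal part separates them: \<open>D(U)V = qVD(U)\<close> gives the
  relation for \<open>\<alpha>\<^sub>1\<beta>\<^sub>2\<close>, and \<open>D(V)U = q\<^sup>-\<^sup>1UD(V)\<close> the one for \<open>\<beta>\<^sub>1\<gamma>\<^sub>2\<close>.\<close>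

lemma diag_cross_commute_iff:
  assumes "q \<noteq> 0" "inv_upper_triangular U" "inv_upper_triangular V"
  shows "cross_commute upper_group (scalar_mat smul q) (diag_part U, diag_part V) (U, V) \<longleftrightarrow>
    IND1 U \<and> IND1 V \<and> MND smul q U V \<and>
    mat_alpha U * mat_alpha V = smul q (mat_alpha V * mat_alpha U) \<and>
    mat_gamma U * mat_gamma V = smul q (mat_gamma V * mat_gamma U)"
  using assms
  by (simp add: cross_commute_def inv_scalar_mat q_commute_upper_iff q_commute_upper_one_iff
      matrix_2_eq_iff matrix_2_mult_nth inv_upper_triangular_def smul_eq_inverse_iff
      IND1_def MND_def) (intro iffI conjI; elim conjE; (assumption | rule sym, assumption))

lemma diag_swap_cross_commute_iff:
  assumes "q \<noteq> 0"
  shows "cross_commute upper_group (scalar_mat smul (inverse q))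
      (diag_swap U, diag_swap V) (diag_part U, diag_part V) \<longleftrightarrow>
    ID2 U \<and> ID2 V \<and>
    mat_alpha U * mat_gamma V = smul (inverse q) (mat_gamma V * mat_alpha U) \<and>
    mat_alpha V * mat_gamma U = smul q (mat_gamma U * mat_alpha V)"
  using assms
  by (simp add: cross_commute_def inv_scalar_mat q_commute_upper_iff q_commute_upper_one_iff
      matrix_2_eq_iff matrix_2_mult_nth smul_eq_inverse_iff ID2_def)
    (intro iffI conjI; elim conjE; (assumption | rule sym, assumption))

text \<open>In type I the relation between \<open>\<gamma>\<^sub>1\<close> and \<open>\<gamma>\<^sub>2\<close> comes from the one between \<open>\<alpha>\<^sub>1\<close> and \<open>\<alpha>\<^sub>2\<close> by
  inverting both sides.\<close>

lemma QMP1_iff: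
  assumes "q \<noteq> 0"
  shows "(U, V) \<in> QMP1 smul q \<longleftrightarrow> inv_upper_triangular U \<and> inv_upper_triangular V \<and>
    diag_swap U = inv\<^bsub>upper_group\<^esub> (diag_part U) \<and>
    diag_swap V = inv\<^bsub>upper_group\<^esub> (diag_part V) \<and>
    cross_commute upper_group (scalar_mat smul q) (diag_part U, diag_part V) (U, V)"
proof -
  have "mat_gamma U * mat_gamma V = smul q (mat_gamma V * mat_gamma U)"
    if U: "ID1 U" and V: "ID1 V"
      and UV: "mat_alpha U * mat_alpha V = smul q (mat_alpha V * mat_alpha U)"
  proof -
    have "mat_alpha U * mat_alpha V * (mat_gamma V * mat_gamma U) =
        mat_alpha U * (mat_alpha V * mat_gamma V) * mat_gamma U"
      by (simp only: mult.assoc)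
    then have "mat_gamma U * mat_gamma V =
        mat_gamma U * mat_gamma V * (mat_alpha U * mat_alpha V * (mat_gamma V * mat_gamma U))"
      using U V by (simp add: ID1_def)
    also have "\<dots> = smul q ((mat_gamma U * (mat_gamma V * mat_alpha V) * mat_alpha U) *
        (mat_gamma V * mat_gamma U))"
      by (simp only: UV smul_mult_left smul_mult_right mult.assoc)
    finally show ?thesis using U V by (simp add: ID1_def)
  qed
  then show ?thesis
    using assms by (simp add: QMP1_def MD1_def ID1_iff[symmetric] diag_cross_commute_iff cong: conj_cong) blast
qed

lemma QMP2_iff:
  assumes "q \<noteq> 0"
  shows "(U, V) \<in> QMP2 smul q \<longleftrightarrow> inv_upper_triangular U \<and> inv_upper_triangular V \<and>
    cross_commute upper_group (scalar_mat smul q) (diag_part U, diag_part V) (U, V) \<and>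
    cross_commute upper_group (scalar_mat smul (inverse q))
      (diag_swap U, diag_swap V) (diag_part U, diag_part V)"
  using assms
  by (simp add: QMP2_def MD2_def diag_cross_commute_iff diag_swap_cross_commute_iff cong: conj_cong) blast

lemma cross_commute_imp_q_commute:
  assumes "q \<noteq> 0" "inv_upper_triangular U" "inv_upper_triangular V"
    and "cross_commute upper_group (scalar_mat smul q) (diag_part U, diag_part V) (U, V)"
  shows "q_commute upper_group (scalar_mat smul q) U V"
  using assms
  by (simp add: diag_cross_commute_iff q_commute_upper_iff matrix_2_eq_iff matrix_2_mult_nth
      inv_upper_triangular_def MND_def scale_right_distrib add.commute)

end

section \<open>Actions of the modular group\<close>

lemma group_SL2Z: "group SL2Z"
proof (rule groupI)
  fix A assume "A \<in> carrier SL2Z"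
  then have det: "A$1$1 * A$2$2 - A$1$2 * A$2$1 = 1"
    by (simp add: SL2Z_def det_2)
  define B :: "int^2^2" where "B = vector [vector [A$2$2, - (A$1$2)], vector [- (A$2$1), A$1$1]]"
  have "B ** A = mat 1"
    using det by (simp add: B_def matrix_2_eq_iff matrix_2_mult_nth mat_2_nth algebra_simps)
  moreover have "det B = 1"
    using det by (simp add: B_def det_2 algebra_simps)
  ultimately show "\<exists>B\<in>carrier SL2Z. B \<otimes>\<^bsub>SL2Z\<^esub> A = \<one>\<^bsub>SL2Z\<^esub>"
    by (auto simp: SL2Z_def)
qed (auto simp: SL2Z_def det_mul matrix_mul_assoc)

text \<open>Bijections of \<open>X\<close> have to be extensional functions here, hence the restriction.\<close>

lemma group_action_restrict:
  fixes G (structure)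
  assumes "group G"
    and closed: "\<And>g x. g \<in> carrier G \<Longrightarrow> x \<in> X \<Longrightarrow> f g x \<in> X"
    and one: "\<And>x. x \<in> X \<Longrightarrow> f \<one> x = x"
    and mult: "\<And>g h x. g \<in> carrier G \<Longrightarrow> h \<in> carrier G \<Longrightarrow> x \<in> X \<Longrightarrow> f (g \<otimes> h) x = f g (f h x)"
  shows "group_action G X (\<lambda>g. restrict (f g) X)"
proof -
  interpret group G by fact
  have Bij: "restrict (f g) X \<in> Bij X" if g: "g \<in> carrier G" for g
  proof -
    have "bij_betw (f g) X X"
      using g mult[of "inv g" g] mult[of g "inv g"]
      by (intro bij_betw_byWitness[where f' = "f (inv g)"]) (auto simp: closed one)
    then show ?thesis by (simp add: Bij_def)
  qed
  have "restrict (f (g \<otimes> h)) X = compose X (restrict (f g) X) (restrict (f h) X)"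
    if "g \<in> carrier G" "h \<in> carrier G" for g h
    using that by (auto simp: fun_eq_iff compose_def closed mult)
  then have "(\<lambda>g. restrict (f g) X) \<in> hom G (BijGroup X)"
    by (auto simp: hom_def BijGroup_def Bij)
  then show ?thesis
    by (intro group_action.intro group_hom.intro group_hom_axioms.intro group_BijGroup is_group)
qed

lemma bij_betw_if_power_eq_id:
  assumes "\<And>x. x \<in> X \<Longrightarrow> f x \<in> X" and "\<And>x. x \<in> X \<Longrightarrow> (f ^^ Suc n) x = x"
  shows "bij_betw f X X"
proof -
  have "(f ^^ n) x \<in> X" if "x \<in> X" for x
    using that by (induction n) (simp_all add: assms(1))
  then show ?thesis
    using assms by (intro bij_betw_byWitness[where f' = "f ^^ n"])
      (auto simp: funpow_swap1)
qed

text \<open>Both \<open>S\<close> and \<open>ST\<close> are invertible because they have finite order, and hence so is \<open>T\<close>.\<close>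

lemma modular_presentation_repI:
  assumes S: "\<And>x. x \<in> X \<Longrightarrow> S x \<in> X" and T: "\<And>x. x \<in> X \<Longrightarrow> T x \<in> X"
    and S4: "\<And>x. x \<in> X \<Longrightarrow> S (S (S (S x))) = x"
    and ST3: "\<And>x. x \<in> X \<Longrightarrow> S (T (S (T (S (T x))))) = x"
  shows "modular_presentation_rep X S T"
proof -
  have bij_S: "bij_betw S X X"
    using S S4 by (intro bij_betw_if_power_eq_id[where n = 3]) (simp_all add: numeral_3_eq_3)
  have "bij_betw (S \<circ> T) X X"
    using S T ST3 by (intro bij_betw_if_power_eq_id[where n = 2]) (simp_all add: numeral_2_eq_2)
  moreover have "T ` X \<subseteq> X" using T by blast
  ultimately have "bij_betw T X X"
    using bij_betw_comp_iff2[OF bij_S] by blast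
  then show ?thesis
    using bij_S S4 ST3 by (simp add: modular_presentation_rep_def eval_nat_numeral)
qed

lemma SL2Z_matrix_rep_imp_modular_presentation_rep:
  assumes "SL2Z_matrix_rep X S T"
  shows "modular_presentation_rep X S T"
proof -
  obtain \<phi> where "group_action SL2Z X \<phi>"
    and S: "\<And>x. x \<in> X \<Longrightarrow> \<phi> SL2Z_S x = S x" and T: "\<And>x. x \<in> X \<Longrightarrow> \<phi> SL2Z_T x = T x"
    using assms by (auto simp: SL2Z_matrix_rep_def)
  interpret group_action SL2Z X \<phi> by fact
  have S_in: "S x \<in> X" if "x \<in> X" for x
    using element_image[OF SL2Z_generators(1) that S[OF that]] .
  have T_in: "T x \<in> X" if "x \<in> X" for x
    using element_image[OF SL2Z_generators(2) that T[OF that]] .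
  have comp: "\<phi> (A ** B) x = \<phi> A (\<phi> B x)" if "det A = 1" "det B = 1" "x \<in> X" for A B x
    using composition_rule[of x A B] that by (simp add: SL2Z_def)
  have one: "\<phi> (mat 1) x = x" if "x \<in> X" for x
    using id_eq_one that by (simp add: SL2Z_def fun_eq_iff) (metis restrict_apply')
  have det: "det SL2Z_S = 1" "det SL2Z_T = 1"
    using SL2Z_generators by (simp_all add: SL2Z_def)
  show ?thesis
  proof (rule modular_presentation_repI[OF S_in T_in])
    fix x assume x: "x \<in> X"
    have "S (S (S (S x))) = \<phi> (SL2Z_S ** SL2Z_S ** SL2Z_S ** SL2Z_S) x"
      using x by (simp add: comp det det_mul S S_in)
    then show "S (S (S (S x))) = x"
      by (simp only: SL2Z_relations one x)
    have "S (T (S (T (S (T x))))) =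
        \<phi> ((SL2Z_S ** SL2Z_T) ** (SL2Z_S ** SL2Z_T) ** (SL2Z_S ** SL2Z_T)) x"
      using x by (simp add: comp det det_mul S T S_in T_in)
    then show "S (T (S (T (S (T x))))) = x"
      by (simp only: SL2Z_relations one x)
  qed
qed

definition weyl_action ::
  "('k \<Rightarrow> 'a::ring_1 \<Rightarrow> 'a) \<Rightarrow> 'k \<Rightarrow> int^2^2 \<Rightarrow> ('a^2^2) \<times> ('a^2^2) \<Rightarrow> ('a^2^2) \<times> ('a^2^2)" where
  "weyl_action smul r A p =
     (weyl upper_group (scalar_mat smul r) p (A$1$1) (A$1$2),
      weyl upper_group (scalar_mat smul r) p (A$2$1) (A$2$2))"

context algebra_over_field
begin

lemma weyl_hom_upper:
  assumes "h \<in> hom upper_group upper_group" "h (scalar_mat smul r) = scalar_mat smul r" "r \<noteq> 0"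
    and "inv_upper_triangular U" "inv_upper_triangular V"
  shows "h (weyl upper_group (scalar_mat smul r) (U, V) a b) =
    weyl upper_group (scalar_mat smul r) (h U, h V) a b"
  using weyl_hom[OF assms(1) group_upper_group group_upper_group, of "scalar_mat smul r" U V] assms
  by (simp add: scalar_mat_closed)

lemma weyl_action_closed:
  assumes r: "r \<noteq> 0" "q = r * r" and A: "A \<in> carrier SL2Z" and UV: "(U, V) \<in> QMP1 smul q"
  shows "weyl_action smul r A (U, V) \<in> QMP1 smul q"
proof -
  have q: "q \<noteq> 0" using r by simp
  let ?z = "scalar_mat smul r" and ?D = diag_part
  let ?W = "weyl upper_group ?z (U, V)" and ?WD = "weyl upper_group ?z (?D U, ?D V)"
  have UV': "inv_upper_triangular U" "inv_upper_triangular V"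
    "diag_swap U = inv\<^bsub>upper_group\<^esub> (?D U)" "diag_swap V = inv\<^bsub>upper_group\<^esub> (?D V)"
    and cross: "cross_commute upper_group (scalar_mat smul q) (?D U, ?D V) (U, V)"
    using UV q by (simp_all add: QMP1_iff)
  note z = central_scalar_mat[OF r(1)]
  have W_closed: "inv_upper_triangular (?W a b)" for a b
    using upper.weyl_closed[of ?z U V a b] UV' r by (simp add: scalar_mat_closed)
  have D_W: "?D (?W a b) = ?WD a b" for a b
    using UV' r by (intro weyl_hom_upper diag_part_hom) simp_all
  have "?D U ** ?D V = scalar_mat smul q ** (?D V ** ?D U)"
    using cross q UV'(1,2)
    by (simp add: diag_cross_commute_iff scalar_mat_mult_left matrix_2_eq_iff matrix_2_mult_nth)
  then have DU_DV: "q_commute upper_group (?z \<otimes>\<^bsub>upper_group\<^esub> ?z) (?D U) (?D V)"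
    by (simp add: q_commute_def scalar_mat_mult r(2))
  (* The swapped diagonal of a monomial is the monomial in the inverted diagonals, i.e. the one
     with exponents (-a,-b) in the diagonals, and this inverts the one with exponents (a,b). *)
  have swap_W: "diag_swap (?W a b) = inv\<^bsub>upper_group\<^esub> (?D (?W a b))" for a b
  proof -
    have "diag_swap (?W a b) = weyl upper_group ?z (diag_swap U, diag_swap V) a b"
      using UV' r by (intro weyl_hom_upper diag_swap_hom) simp_all
    also have "\<dots> = ?WD (- a) (- b)"
      using UV' by (simp add: upper.weyl_of_inverses)
    also have "\<dots> = inv\<^bsub>upper_group\<^esub> (?WD a b)"
      using UV' upper.weyl_inverse[OF z DU_DV] by simp
    finally show ?thesis by (simp only: D_W)
  qed
  (* Taking (a,b) and (c,d) among the rows of A gives the exponents 0, 0, 1, -1. *)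
  have commute: "q_commute upper_group (scalar_mat smul q [^]\<^bsub>upper_group\<^esub> (a * d - b * c))
      (?WD a b) (?W c d)" for a b c d
    using UV' q by (intro upper.weyl_q_commute[OF z z central_scalar_mat] cross) simp_all
  have det: "A$1$1 * A$2$2 - A$1$2 * A$2$1 = 1" "A$1$2 * A$2$1 - A$1$1 * A$2$2 = - 1"
    using A by (simp_all add: SL2Z_def det_2 algebra_simps)
  have "cross_commute upper_group (scalar_mat smul q)
      (?WD (A$1$1) (A$1$2), ?WD (A$2$1) (A$2$2)) (?W (A$1$1) (A$1$2), ?W (A$2$1) (A$2$2))"
    using commute[of "A$1$1" "A$1$2" "A$1$2" "A$1$1"] commute[of "A$2$1" "A$2$2" "A$2$2" "A$2$1"]
      commute[of "A$1$1" "A$2$2" "A$1$2" "A$2$1"] commute[of "A$2$1" "A$1$2" "A$2$2" "A$1$1"]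
    using scalar_mat_closed[OF q]
    by (simp add: cross_commute_def det upper.int_pow_neg mult.commute)
  then show ?thesis
    by (simp add: weyl_action_def QMP1_iff[OF q] W_closed swap_W D_W)
qed

lemma QMP1_imp_q_commute:
  assumes "r \<noteq> 0" "q = r * r" "(U, V) \<in> QMP1 smul q"
  shows "q_commute upper_group (scalar_mat smul r \<otimes>\<^bsub>upper_group\<^esub> scalar_mat smul r) U V"
  using assms by (simp add: scalar_mat_mult QMP1_iff cross_commute_imp_q_commute)

text \<open>The monomials of the image pair are formed with the rows of \<open>B\<close>, and the rows of \<open>A ** B\<close> are the
  combinations of these with coefficients from \<open>A\<close>; so this is a left action.\<close>

lemma weyl_action_mult:
  assumes r: "r \<noteq> 0" "q = r * r" and B: "B \<in> carrier SL2Z" and UV: "(U, V) \<in> QMP1 smul q"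
  shows "weyl_action smul r (A ** B) (U, V) = weyl_action smul r A (weyl_action smul r B (U, V))"
proof -
  have "inv_upper_triangular U" "inv_upper_triangular V"
    using UV by (auto simp: QMP1_def)
  moreover have "B$1$1 * B$2$2 - B$1$2 * B$2$1 = 1"
    using B by (simp add: SL2Z_def det_2)
  ultimately show ?thesis
    using upper.weyl_weyl[OF central_scalar_mat[OF r(1)] QMP1_imp_q_commute[OF r UV]]
    by (simp add: weyl_action_def matrix_2_mult_nth)
qed

lemma SL2Z_matrix_rep_QMP1:
  assumes r: "r \<noteq> 0" "q = r * r"
  shows "SL2Z_matrix_rep (QMP1 smul q) S_map (T1_map smul r)"
proof -
  let ?\<phi> = "\<lambda>A. restrict (weyl_action smul r A) (QMP1 smul q)"
  have upper: "inv_upper_triangular U" "inv_upper_triangular V" if "(U, V) \<in> QMP1 smul q" for U V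
    using that by (auto simp: QMP1_def)
  note weyl_simps = weyl_action_def upper scalar_mat_closed[OF r(1)] mat_2_nth
  have "group_action SL2Z (QMP1 smul q) ?\<phi>"
  proof (rule group_action_restrict[OF group_SL2Z])
    fix p assume "p \<in> QMP1 smul q"
    then show "weyl_action smul r \<one>\<^bsub>SL2Z\<^esub> p = p"
      by (cases p) (simp add: SL2Z_def weyl_simps)
  next
    fix A p assume "A \<in> carrier SL2Z" "p \<in> QMP1 smul q"
    then show "weyl_action smul r A p \<in> QMP1 smul q"
      by (cases p) (simp add: weyl_action_closed r)
  next
    fix A B p assume "B \<in> carrier SL2Z" "p \<in> QMP1 smul q"
    then show "weyl_action smul r (A \<otimes>\<^bsub>SL2Z\<^esub> B) p = weyl_action smul r A (weyl_action smul r B p)"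
      using weyl_action_mult[OF r, of B "fst p" "snd p" A] by (simp add: SL2Z_def)
  qed
  moreover have "weyl_action smul r SL2Z_S (U, V) = S_map (U, V)" if UV: "(U, V) \<in> QMP1 smul q" for U V
  proof -
    have "weyl upper_group (scalar_mat smul r) (U, V) (- 1) 0 = inv\<^bsub>upper_group\<^esub> U"
      using upper.weyl_inverse[OF central_scalar_mat[OF r(1)] QMP1_imp_q_commute[OF r UV], of 1 0] upper[OF UV]
      by (simp add: scalar_mat_closed r)
    then show ?thesis
      using UV by (simp add: SL2Z_S_def S_map_eq_inv weyl_simps)
  qed
  moreover have "weyl_action smul r SL2Z_T (U, V) = T1_map smul r (U, V)" if UV: "(U, V) \<in> QMP1 smul q" for U V
  proof -
    have "weyl upper_group (scalar_mat smul r) (U, V) 1 1 = map_matrix (smul (inverse r)) (U ** V)"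
      using upper.int_pow_neg[of "scalar_mat smul r" 1] UV r
      by (simp add: weyl_def weyl_simps inv_scalar_mat scalar_mat_mult_left)
    then show ?thesis
      using UV by (simp add: SL2Z_T_def T1_map_def weyl_simps)
  qed
  ultimately show ?thesis
    unfolding SL2Z_matrix_rep_def by (intro exI[of _ ?\<phi>]) auto
qed

lemma modular_presentation_rep_QMP2:
  assumes q: "q \<noteq> 0"
  shows "modular_presentation_rep (QMP2 smul q) S_map T2_map"
proof -
  have upper: "inv_upper_triangular U" "inv_upper_triangular V" if "(U, V) \<in> QMP2 smul q" for U V
    using that by (auto simp: QMP2_def)
  note S_eq = S_map_eq_inv and T_eq = T2_map_def
  note closed = inv_upper_triangular_mult inv_upper_triangular_inv
  note diag_mult = hom_mult[OF diag_part_hom, simplified] hom_mult[OF diag_swap_hom, simplified]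
  interpret part: group_hom upper_group upper_group diag_part
    by (intro group_hom.intro group_hom_axioms.intro group_upper_group diag_part_hom)
  interpret swap: group_hom upper_group upper_group diag_swap
    by (intro group_hom.intro group_hom_axioms.intro group_upper_group diag_swap_hom)
  have qinv: "inverse q \<noteq> 0" using q by simp
  note central = central_scalar_mat[OF q] central_scalar_mat[OF qinv]
  show ?thesis
  proof (rule modular_presentation_repI)
    fix p assume "p \<in> QMP2 smul q"
    then obtain U V where p: "p = (U, V)" and UV: "(U, V) \<in> QMP2 smul q" by (cases p) auto
    note carr = upper[OF UV]
    show "S_map p \<in> QMP2 smul q"
      using UV carr central closed part.hom_inv[of U] swap.hom_inv[of U]
      by (simp add: p S_eq QMP2_iff[OF q] upper.cross_commute_S)
    show "T2_map p \<in> QMP2 smul q"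
      using UV carr central closed
        upper.cross_commute_T[of "scalar_mat smul q" "diag_part U" "diag_part V" U V]
        upper.cross_commute_T[of "scalar_mat smul (inverse q)" "diag_swap U" "diag_swap V" "diag_part U" "diag_part V"]
      by (simp add: p T_eq QMP2_iff[OF q] diag_mult)
    show "S_map (S_map (S_map (S_map p))) = p"
      using carr by (simp add: p S_eq closed)
    show "S_map (T2_map (S_map (T2_map (S_map (T2_map p))))) = p"
    proof -
      (* The composite of the two maps shifts the cyclic sequence U, V, W with UVW = 1. *)
      let ?W = "inv\<^bsub>upper_group\<^esub> (U ** V)"
      have "S_map (T2_map p) = (V, ?W)"
        using carr by (simp add: p S_eq T_eq closed)
      moreover have "V \<otimes>\<^bsub>upper_group\<^esub> ?W = inv\<^bsub>upper_group\<^esub> U"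
        using carr upper.mult_inv_mult_cancel[of U V] by simp
      then have "S_map (T2_map (V, ?W)) = (?W, U)"
        using carr by (simp add: S_eq T_eq closed)
      moreover have "?W \<otimes>\<^bsub>upper_group\<^esub> U = inv\<^bsub>upper_group\<^esub> V"
        using carr upper.mult_inv_mult_cancel[of U V] by simp
      then have "S_map (T2_map (?W, U)) = (U, V)"
        using carr by (simp add: S_eq T_eq closed)
      ultimately show ?thesis by (simp add: p)
    qed
  qed
qed

end

theorem theorem3:
  fixes smul :: "'k::field \<Rightarrow> 'a::ring_1 \<Rightarrow> 'a" and q :: 'k
  assumes "algebra_over_field smul" and "q \<noteq> 0" and "q \<noteq> 1"
  shows "(\<forall>r. r ^ 2 = q \<longrightarrow>
            modular_presentation_rep (QMP1 smul q) S_map (T1_map smul r) \<and>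
            SL2Z_matrix_rep (QMP1 smul q) S_map (T1_map smul r)) \<and>
         modular_presentation_rep (QMP2 smul q) S_map T2_map"
proof -
  interpret algebra_over_field smul by fact
  have "SL2Z_matrix_rep (QMP1 smul q) S_map (T1_map smul r)" if "r ^ 2 = q" for r
    using that assms(2) by (intro SL2Z_matrix_rep_QMP1) (auto simp: power2_eq_square)
  then show ?thesis
    using modular_presentation_rep_QMP2 assms(2) SL2Z_matrix_rep_imp_modular_presentation_rep
    by blast
qed

end
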